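(* A semigroup is left equalizer simple if and only if it is isomorphic to a semigroup $(S;\star)$ obtained by Construction 1 (described in the context) from some left cancellative semigroup $T$, some family of pairwise disjoint non-empty sets $(S_t)_{t\in T}$, and some family of mappings $f_{(t,r)}$ ($t\in T$, $r\in tT$) satisfying the conditions of Construction 1.
   Context: A semigroup $S$ is called left equalizer simple if, for every non-empty subset $H$ of $S$, the left equalizer $\{x\in S: xa=xb \text{ for all } a,b\in H\}$ of $H$ is either empty or equal to $S$; equivalently, for all $a,b\in S$, if $x_0a=x_0b$ for some $x_0\in S$, then $xa=xb$ for all $x\in S$. A semigroup $T$ is left cancellative if, for all $x,a,b\in T$, $xa=xb$ implies $a=b$. Construction 1. Let $T$ be a left cancellative semigroup. With each $t\in T$ associate a non-empty set $S_t$ such that $S_t\cap S_r=\emptyset$ whenever $t\neq r$. For every pair $(t,r)\in T\times T$ with $r\in tT$, let $f_{(t,r)}: S_t\to S_r$ be a mapping (written on the right of its argument), and assume that for all $t\in T$, $r\in tT$, $q\in rT\subseteq tT$ and $a\in S_t$, $$((a)f_{(t,r)})f_{(r,q)}=(a)f_{(t,q)}.$$ On the set $S=\bigcup_{t\in T}S_t$ define an operation $\star$ by $$a\star b=(a)f_{(t,tx)}\qquad\text{for } a\in S_t,\ b\in S_x,\ t,x\in T.$$ Then $(S;\star)$ is a semigroup. *)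

theory Defs
  imports "HOL-Algebra.Coset" "HOL-Library.Disjoint_Sets"
begin

text \<open>
  HOL-Algebra has no structure below \<^locale>\<open>monoid\<close>. Semigroups are therefore represented by
  \<^typ>\<open>'a monoid\<close> records of which only the fields carrier and mult are used; the field one is
  arbitrary and unconstrained. The library's homomorphisms (\<^const>\<open>hom\<close>), isomorphisms
  (\<^const>\<open>iso\<close>, \<^const>\<open>is_iso\<close>) and translates (\<^const>\<open>l_coset\<close>) do not refer to it either.
  The empty semigroup is not excluded.
\<close>

locale semigrp =
  fixes G (structure)
  assumes m_closed: "\<lbrakk>x \<in> carrier G; y \<in> carrier G\<rbrakk> \<Longrightarrow> x \<otimes> y \<in> carrier G"
    and m_assoc: "\<lbrakk>x \<in> carrier G; y \<in> carrier G; z \<in> carrier G\<rbrakk>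
      \<Longrightarrow> (x \<otimes> y) \<otimes> z = x \<otimes> (y \<otimes> z)"

definition left_equalizer :: "('a, 'm) monoid_scheme \<Rightarrow> 'a set \<Rightarrow> 'a set" where
  "left_equalizer G H =
    {x \<in> carrier G. \<forall>a\<in>H. \<forall>b\<in>H. x \<otimes>\<^bsub>G\<^esub> a = x \<otimes>\<^bsub>G\<^esub> b}"

definition left_equalizer_simple :: "('a, 'm) monoid_scheme \<Rightarrow> bool" where
  "left_equalizer_simple G \<longleftrightarrow> semigrp G \<and>
    (\<forall>H. H \<subseteq> carrier G \<and> H \<noteq> {} \<longrightarrow>
      left_equalizer G H = {} \<or> left_equalizer G H = carrier G)"

locale left_cancellative_semigrp = semigrp +
  assumes left_cancel: "\<lbrakk>x \<in> carrier G; a \<in> carrier G; b \<in> carrier G; x \<otimes> a = x \<otimes> b\<rbrakk>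
      \<Longrightarrow> a = b"

text \<open>
  The right ideal \<open>tT\<close> is \<open>t <# carrier T\<close>, which need not contain \<open>t\<close>.
  The map \<open>f\<^sub>(\<^sub>t\<^sub>,\<^sub>r\<^sub>)\<close> is \<open>f t r\<close>; its values are constrained
  only for \<open>t \<in> T\<close> and \<open>r \<in> tT\<close>, and only on \<open>A t\<close>.
\<close>

locale construction1 = left_cancellative_semigrp T for T (structure) +
  fixes A :: "'t \<Rightarrow> 's set" and f :: "'t \<Rightarrow> 't \<Rightarrow> 's \<Rightarrow> 's"
  assumes nonempty: "t \<in> carrier T \<Longrightarrow> A t \<noteq> {}"
    and disjoint: "disjoint_family_on A (carrier T)"
    and maps: "\<lbrakk>t \<in> carrier T; r \<in> t <# carrier T\<rbrakk> \<Longrightarrow> f t r \<in> A t \<rightarrow> A r"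
    and comp: "\<lbrakk>t \<in> carrier T; r \<in> t <# carrier T; q \<in> r <# carrier T; a \<in> A t\<rbrakk>
      \<Longrightarrow> f r q (f t r a) = f t q a"

definition idx :: "('t, 'm) monoid_scheme \<Rightarrow> ('t \<Rightarrow> 's set) \<Rightarrow> 's \<Rightarrow> 't" where
  "idx T A a = (THE t. t \<in> carrier T \<and> a \<in> A t)"

definition constr1 ::
  "('t, 'm) monoid_scheme \<Rightarrow> ('t \<Rightarrow> 's set) \<Rightarrow> ('t \<Rightarrow> 't \<Rightarrow> 's \<Rightarrow> 's) \<Rightarrow> 's monoid" where
  "constr1 T A f =
    \<lparr>carrier = (\<Union>t\<in>carrier T. A t),
     mult = (\<lambda>a b. f (idx T A a) (idx T A a \<otimes>\<^bsub>T\<^esub> idx T A b) a),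
     one = undefined\<rparr>"

context construction1
begin

lemma idx_eq: "\<lbrakk>t \<in> carrier T; a \<in> A t\<rbrakk> \<Longrightarrow> idx T A a = t"
  unfolding idx_def using disjoint by (intro the_equality) (auto simp: disjoint_family_on_def)

lemma mult_constr1:
  "\<lbrakk>t \<in> carrier T; x \<in> carrier T; a \<in> A t; b \<in> A x\<rbrakk>
    \<Longrightarrow> a \<otimes>\<^bsub>constr1 T A f\<^esub> b = f t (t \<otimes> x) a"
  by (simp add: constr1_def idx_eq)

lemma mult_in_coset: "\<lbrakk>t \<in> carrier T; x \<in> carrier T\<rbrakk> \<Longrightarrow> t \<otimes> x \<in> t <# carrier T"
  by (auto simp: l_coset_def)

lemma mult_constr1_in:
  "\<lbrakk>t \<in> carrier T; x \<in> carrier T; a \<in> A t; b \<in> A x\<rbrakk>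
    \<Longrightarrow> a \<otimes>\<^bsub>constr1 T A f\<^esub> b \<in> A (t \<otimes> x)"
  using maps[OF _ mult_in_coset] by (auto simp: mult_constr1)

lemma semigrp_constr1: "semigrp (constr1 T A f)"
proof
  fix a b assume "a \<in> carrier (constr1 T A f)" "b \<in> carrier (constr1 T A f)"
  then obtain t x where "t \<in> carrier T" "x \<in> carrier T" "a \<in> A t" "b \<in> A x"
    by (auto simp: constr1_def)
  then show "a \<otimes>\<^bsub>constr1 T A f\<^esub> b \<in> carrier (constr1 T A f)"
    using mult_constr1_in[of t x a b] m_closed by (auto simp: constr1_def)
next
  fix a b c assume "a \<in> carrier (constr1 T A f)" "b \<in> carrier (constr1 T A f)"
    "c \<in> carrier (constr1 T A f)"
  then obtain t x y where *: "t \<in> carrier T" "x \<in> carrier T" "y \<in> carrier T"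
    "a \<in> A t" "b \<in> A x" "c \<in> A y"
    by (auto simp: constr1_def)
  have ab: "a \<otimes>\<^bsub>constr1 T A f\<^esub> b \<in> A (t \<otimes> x)"
    and bc: "b \<otimes>\<^bsub>constr1 T A f\<^esub> c \<in> A (x \<otimes> y)"
    using * mult_constr1_in by auto
  have "(a \<otimes>\<^bsub>constr1 T A f\<^esub> b) \<otimes>\<^bsub>constr1 T A f\<^esub> c
      = f (t \<otimes> x) (t \<otimes> x \<otimes> y) (f t (t \<otimes> x) a)"
    using * ab by (simp add: mult_constr1[OF _ _ ab] mult_constr1 m_closed)
  also have "\<dots> = f t (t \<otimes> x \<otimes> y) a"
    using * by (intro comp mult_in_coset m_closed)
  also have "\<dots> = a \<otimes>\<^bsub>constr1 T A f\<^esub> (b \<otimes>\<^bsub>constr1 T A f\<^esub> c)"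
    using * bc by (simp add: mult_constr1[OF _ _ _ bc] m_closed m_assoc)
  finally show "(a \<otimes>\<^bsub>constr1 T A f\<^esub> b) \<otimes>\<^bsub>constr1 T A f\<^esub> c
      = a \<otimes>\<^bsub>constr1 T A f\<^esub> (b \<otimes>\<^bsub>constr1 T A f\<^esub> c)" .
qed

end

end

theory Submission
  imports Defs
begin

text \<open>
  In a semigroup obtained by Construction 1, an equation \<open>x\<^sub>0 \<star> a = x\<^sub>0 \<star> b\<close> forces \<open>a\<close> and \<open>b\<close> to have
  the same index, by left cancellation in \<open>T\<close>, and \<open>x \<star> a\<close> depends on \<open>a\<close> only through its index.
  Conversely, the relation ``\<open>xa = xb\<close> for all \<open>x\<close>'' is a congruence on any semigroup; left equalizer
  simplicity makes the quotient \<open>T\<close> left cancellative and makes \<open>ax\<close> depend only on \<open>a\<close> and the class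
  of \<open>ax\<close>. Taking the classes themselves as the sets \<open>S\<^sub>t\<close> and \<open>(a)f\<^sub>(\<^sub>t\<^sub>,\<^sub>r\<^sub>) = ax\<close> for any \<open>x\<close> with \<open>ax \<in> r\<close>,
  Construction 1 returns the original semigroup, the isomorphism being the identity.
\<close>

text \<open>For one direction take \<open>H = {a, b}\<close>, whose left equalizer contains
  \<open>x0\<close>. For the other, a single element of the left equalizer of \<open>H\<close>
  serves as \<open>x0\<close> for every pair from \<open>H\<close> at once.\<close>

lemma left_equalizer_simple_iff:
  "left_equalizer_simple G \<longleftrightarrow> semigrp G \<and>
    (\<forall>x0\<in>carrier G. \<forall>a\<in>carrier G. \<forall>b\<in>carrier G. x0 \<otimes>\<^bsub>G\<^esub> a = x0 \<otimes>\<^bsub>G\<^esub> b \<longrightarrow>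
      (\<forall>x\<in>carrier G. x \<otimes>\<^bsub>G\<^esub> a = x \<otimes>\<^bsub>G\<^esub> b))"
  (is "_ \<longleftrightarrow> _ \<and> ?R")
proof -
  have ?R if *: "\<forall>H. H \<subseteq> carrier G \<and> H \<noteq> {} \<longrightarrow>
      left_equalizer G H = {} \<or> left_equalizer G H = carrier G"
  proof (intro ballI impI)
    fix x0 a b x
    assume "x0 \<in> carrier G" "a \<in> carrier G" "b \<in> carrier G" "x0 \<otimes>\<^bsub>G\<^esub> a = x0 \<otimes>\<^bsub>G\<^esub> b"
      and x: "x \<in> carrier G"
    then have "x0 \<in> left_equalizer G {a, b}" "{a, b} \<subseteq> carrier G"
      by (auto simp: left_equalizer_def)
    then have "x \<in> left_equalizer G {a, b}"
      using * x by blast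
    then show "x \<otimes>\<^bsub>G\<^esub> a = x \<otimes>\<^bsub>G\<^esub> b"
      unfolding left_equalizer_def by blast
  qed
  moreover have "left_equalizer G H = carrier G"
    if *: ?R and H: "H \<subseteq> carrier G" and ne: "left_equalizer G H \<noteq> {}" for H
  proof -
    obtain x0 where "x0 \<in> carrier G" "\<And>a b. \<lbrakk>a \<in> H; b \<in> H\<rbrakk> \<Longrightarrow> x0 \<otimes>\<^bsub>G\<^esub> a = x0 \<otimes>\<^bsub>G\<^esub> b"
      using ne unfolding left_equalizer_def by blast
    then have "\<forall>x\<in>carrier G. x \<otimes>\<^bsub>G\<^esub> a = x \<otimes>\<^bsub>G\<^esub> b" if "a \<in> H" "b \<in> H" for a b
      using * H that by (meson subsetD)
    then show ?thesis
      unfolding left_equalizer_def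
      by (intro equalityI subsetI CollectI) (elim CollectE conjE, assumption, meson)
  qed
  ultimately have "(\<forall>H. H \<subseteq> carrier G \<and> H \<noteq> {} \<longrightarrow>
      left_equalizer G H = {} \<or> left_equalizer G H = carrier G) \<longleftrightarrow> ?R"
    by (intro iffI) meson+
  then show ?thesis
    unfolding left_equalizer_simple_def by (rule arg_cong)
qed

text \<open>An equation in \<open>G\<close> is carried to \<open>K\<close> by \<open>h\<close>,
  extended there to all left factors, and pulled back by injectivity of \<open>h\<close>.\<close>

lemma left_equalizer_simple_iso:
  assumes "semigrp G" and iso: "G \<cong> K" and K: "left_equalizer_simple K"
  shows "left_equalizer_simple G"
proof -
  obtain h where h: "h \<in> iso G K"
    using iso by (auto simp: is_iso_def)
  then have inj: "inj_on h (carrier G)" and hom: "h \<in> hom G K"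
    by (auto simp: iso_def bij_betw_def)
  have "x \<otimes>\<^bsub>G\<^esub> a = x \<otimes>\<^bsub>G\<^esub> b"
    if *: "x0 \<in> carrier G" "a \<in> carrier G" "b \<in> carrier G" "x \<in> carrier G"
      and eq: "x0 \<otimes>\<^bsub>G\<^esub> a = x0 \<otimes>\<^bsub>G\<^esub> b" for x0 a b x
  proof -
    have "h x0 \<otimes>\<^bsub>K\<^esub> h a = h x0 \<otimes>\<^bsub>K\<^esub> h b"
      using * eq hom_mult[OF hom] by metis
    then have "h x \<otimes>\<^bsub>K\<^esub> h a = h x \<otimes>\<^bsub>K\<^esub> h b"
      using K * hom_in_carrier[OF hom] unfolding left_equalizer_simple_iff by blast
    then show ?thesis
      using * hom_mult[OF hom] inj_onD[OF inj] semigrp.m_closed[OF \<open>semigrp G\<close>] by metis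
  qed
  with \<open>semigrp G\<close> show ?thesis
    unfolding left_equalizer_simple_iff by blast
qed

lemma (in construction1) left_equalizer_simple_constr1:
  "left_equalizer_simple (constr1 T A f)"
proof -
  have "x \<otimes>\<^bsub>constr1 T A f\<^esub> a = x \<otimes>\<^bsub>constr1 T A f\<^esub> b"
    if *: "x0 \<in> carrier (constr1 T A f)" "a \<in> carrier (constr1 T A f)"
        "b \<in> carrier (constr1 T A f)" "x \<in> carrier (constr1 T A f)"
      and eq: "x0 \<otimes>\<^bsub>constr1 T A f\<^esub> a = x0 \<otimes>\<^bsub>constr1 T A f\<^esub> b" for x0 a b x
  proof -
    obtain t0 t u v where
      t: "t0 \<in> carrier T" "t \<in> carrier T" "u \<in> carrier T" "v \<in> carrier T"
        "x0 \<in> A t0" "a \<in> A t" "b \<in> A u" "x \<in> A v"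
      using * by (auto simp: constr1_def)
    have "x0 \<otimes>\<^bsub>constr1 T A f\<^esub> a \<in> A (t0 \<otimes> t)" "x0 \<otimes>\<^bsub>constr1 T A f\<^esub> a \<in> A (t0 \<otimes> u)"
      using t mult_constr1_in[of t0 t x0 a] mult_constr1_in[of t0 u x0 b] eq by simp_all
    \<comment> \<open>One element lies in both members of the disjoint family, so its index has both
      values.\<close>
    then have "t0 \<otimes> t = t0 \<otimes> u"
      using t m_closed idx_eq by metis
    then have "t = u"
      using t left_cancel by blast
    \<comment> \<open>Both products are now \<open>f v (v \<otimes> t) x\<close>.\<close>
    then show ?thesis
      using t mult_constr1 by metis
  qed
  then show ?thesis
    using semigrp_constr1 unfolding left_equalizer_simple_iff by blast
qed

context semigrp
begin

text \<open>This is the kernel of the right regular representation, which sends \<open>a\<close> to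
  the translation \<open>x \<mapsto> x \<otimes> a\<close>.\<close>

definition same_action :: "('a \<times> 'a) set" where
  "same_action = {(a, b) \<in> carrier G \<times> carrier G. \<forall>x\<in>carrier G. x \<otimes> a = x \<otimes> b}"

definition act_class :: "'a \<Rightarrow> 'a set" where
  "act_class a = same_action `` {a}"

definition act_quotient :: "'a set monoid" where
  "act_quotient =
    \<lparr>carrier = act_class ` carrier G,
     mult = (\<lambda>P Q. act_class ((SOME a. a \<in> P) \<otimes> (SOME b. b \<in> Q))),
     one = undefined\<rparr>"

text \<open>The choice picks some right factor that moves \<open>a\<close> into \<open>r\<close>. In
  a left equalizer simple semigroup all such factors give the same product, as
  \<open>act_map_eq\<close> shows.\<close>

definition act_map :: "'a set \<Rightarrow> 'a set \<Rightarrow> 'a \<Rightarrow> 'a" where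
  "act_map t r a = a \<otimes> (SOME x. x \<in> carrier G \<and> a \<otimes> x \<in> r)"

lemma equiv_same_action: "equiv (carrier G) same_action"
  by (auto simp: equiv_def refl_on_def sym_def trans_def same_action_def)

lemma act_class_eq_iff:
  "\<lbrakk>a \<in> carrier G; b \<in> carrier G\<rbrakk>
    \<Longrightarrow> act_class a = act_class b \<longleftrightarrow> (\<forall>x\<in>carrier G. x \<otimes> a = x \<otimes> b)"
  by (auto simp: act_class_def eq_equiv_class_iff[OF equiv_same_action] same_action_def)

lemma mem_act_class_iff:
  "a \<in> carrier G \<Longrightarrow> b \<in> act_class a \<longleftrightarrow> b \<in> carrier G \<and> act_class b = act_class a"
  using act_class_eq_iff[of b a] by (auto simp: act_class_def same_action_def)

lemma act_class_mult_cong: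
  assumes "a \<in> carrier G" "a' \<in> carrier G" "b \<in> carrier G" "b' \<in> carrier G"
    and "act_class a = act_class a'" "act_class b = act_class b'"
  shows "act_class (a \<otimes> b) = act_class (a' \<otimes> b')"
proof -
  have "x \<otimes> (a \<otimes> b) = x \<otimes> (a' \<otimes> b')" if x: "x \<in> carrier G" for x
  proof -
    \<comment> \<open>The factors are exchanged one at a time; in the second exchange
      \<open>x \<otimes> a'\<close> acts as the left factor.\<close>
    have "x \<otimes> a = x \<otimes> a'" "(x \<otimes> a') \<otimes> b = (x \<otimes> a') \<otimes> b'"
      using assms x by (auto simp: act_class_eq_iff m_closed)
    then show ?thesis
      using assms x by (metis m_assoc)
  qed
  then show ?thesis
    using assms by (simp add: act_class_eq_iff m_closed)
qed

text \<open>The class of \<open>c\<close> contains \<open>c\<close>, so the chosen representative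
  does lie in the class, and the congruence property makes the product independent of the
  choice.\<close>

lemma act_quotient_mult:
  assumes "a \<in> carrier G" "b \<in> carrier G"
  shows "act_class a \<otimes>\<^bsub>act_quotient\<^esub> act_class b = act_class (a \<otimes> b)"
proof -
  have "(SOME d. d \<in> act_class c) \<in> carrier G \<and> act_class (SOME d. d \<in> act_class c) = act_class c"
    if "c \<in> carrier G" for c
    using that someI[of "\<lambda>d. d \<in> act_class c" c] by (simp add: mem_act_class_iff)
  with assms have "act_class ((SOME a'. a' \<in> act_class a) \<otimes> (SOME b'. b' \<in> act_class b)) =
      act_class (a \<otimes> b)"
    by (intro act_class_mult_cong) blast+
  then show ?thesis
    by (simp add: act_quotient_def)
qed

lemma act_quotient_carrier: "carrier act_quotient = act_class ` carrier G"
  by (simp add: act_quotient_def)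

lemma semigrp_act_quotient: "semigrp act_quotient"
  by unfold_locales
    (auto simp: act_quotient_carrier act_quotient_mult m_closed m_assoc)

lemma act_quotient_coset:
  "a \<in> carrier G \<Longrightarrow>
    act_class a <#\<^bsub>act_quotient\<^esub> carrier act_quotient = (\<lambda>x. act_class (a \<otimes> x)) ` carrier G"
  by (auto simp: l_coset_def act_quotient_carrier act_quotient_mult)

end

context
  fixes S :: "('a, 'm) monoid_scheme" (structure)
  assumes les: "left_equalizer_simple S"
begin

interpretation semigrp S
  using les by (simp add: left_equalizer_simple_def)

lemma act_class_left_cancel:
  assumes "x \<in> carrier S" "a \<in> carrier S" "b \<in> carrier S"
    and eq: "act_class (x \<otimes> a) = act_class (x \<otimes> b)"
  shows "act_class a = act_class b"
proof -
  \<comment> \<open>Equality of the classes only compares \<open>x \<otimes> a\<close> and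
    \<open>x \<otimes> b\<close> after a left multiplication. Multiplying by \<open>x\<close> itself
    yields one left factor, \<open>x \<otimes> x\<close>, that identifies \<open>a\<close> and
    \<open>b\<close>; left equalizer simplicity extends this to all left factors.\<close>
  have "(x \<otimes> x) \<otimes> a = (x \<otimes> x) \<otimes> b"
    using eq assms by (simp add: act_class_eq_iff m_closed m_assoc)
  then have "\<forall>y\<in>carrier S. y \<otimes> a = y \<otimes> b"
    using les assms m_closed[of x x] unfolding left_equalizer_simple_iff by blast
  then show ?thesis
    using assms by (simp add: act_class_eq_iff)
qed

text \<open>The chosen factor \<open>y\<close> may differ from \<open>x\<close>, but cancelling
  \<open>a\<close> in the quotient puts both in one class, and elements of one class have the same
  product with \<open>a\<close> on the left.\<close>

lemma act_map_eq:
  assumes "a \<in> carrier S" "x \<in> carrier S"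
  shows "act_map t (act_class (a \<otimes> x)) a = a \<otimes> x"
proof -
  define y where "y = (SOME y. y \<in> carrier S \<and> a \<otimes> y \<in> act_class (a \<otimes> x))"
  have y: "y \<in> carrier S \<and> a \<otimes> y \<in> act_class (a \<otimes> x)"
    unfolding y_def by (rule someI[of _ x]) (simp add: assms mem_act_class_iff m_closed)
  then have "act_class (a \<otimes> y) = act_class (a \<otimes> x)"
    using assms by (simp add: mem_act_class_iff m_closed)
  then have "act_class y = act_class x"
    using assms y act_class_left_cancel by blast
  then have "a \<otimes> y = a \<otimes> x"
    using assms y act_class_eq_iff by blast
  then show ?thesis
    unfolding act_map_def y_def .
qed

text \<open>Any element \<open>a\<close> of a class can represent it, so membership in the right
  ideal becomes an explicit product \<open>a \<otimes> x\<close>, the form to which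
  \<open>act_map_eq\<close> applies.\<close>

lemma act_class_coset_cases:
  assumes "t \<in> carrier act_quotient" "a \<in> t" "r \<in> t <#\<^bsub>act_quotient\<^esub> carrier act_quotient"
  obtains x where "a \<in> carrier S" "t = act_class a" "x \<in> carrier S" "r = act_class (a \<otimes> x)"
proof -
  have a: "a \<in> carrier S" "t = act_class a"
    using assms(1,2) by (auto simp: act_quotient_carrier mem_act_class_iff)
  then show thesis
    using assms(3) that by (auto simp: act_quotient_coset)
qed

lemma construction1_act_quotient: "construction1 act_quotient (\<lambda>t. t) act_map"
proof -
  interpret Q: semigrp act_quotient
    by (rule semigrp_act_quotient)
  show ?thesis
  proof
    fix x a b
    assume "x \<in> carrier act_quotient" "a \<in> carrier act_quotient" "b \<in> carrier act_quotient"
      and eq: "x \<otimes>\<^bsub>act_quotient\<^esub> a = x \<otimes>\<^bsub>act_quotient\<^esub> b"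
    then obtain x' a' b' where *: "x' \<in> carrier S" "a' \<in> carrier S" "b' \<in> carrier S"
      "x = act_class x'" "a = act_class a'" "b = act_class b'"
      by (auto simp: act_quotient_carrier)
    with eq have "act_class (x' \<otimes> a') = act_class (x' \<otimes> b')"
      by (simp add: act_quotient_mult)
    with * show "a = b"
      using act_class_left_cancel by blast
  next
    fix t assume "t \<in> carrier act_quotient"
    then show "t \<noteq> {}"
      using mem_act_class_iff by (auto simp: act_quotient_carrier)
  next
    show "disjoint_family_on (\<lambda>t. t) (carrier act_quotient)"
      using mem_act_class_iff by (auto simp: disjoint_family_on_def act_quotient_carrier)
  next
    fix t r
    assume tr: "t \<in> carrier act_quotient" "r \<in> t <#\<^bsub>act_quotient\<^esub> carrier act_quotient"
    show "act_map t r \<in> t \<rightarrow> r"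
    proof
      fix a assume "a \<in> t"
      from act_class_coset_cases[OF tr(1) this tr(2)] show "act_map t r a \<in> r"
        by (metis act_map_eq m_closed mem_act_class_iff)
    qed
  next
    fix t r q a
    assume *: "t \<in> carrier act_quotient" "r \<in> t <#\<^bsub>act_quotient\<^esub> carrier act_quotient"
      "q \<in> r <#\<^bsub>act_quotient\<^esub> carrier act_quotient" "a \<in> t"
    obtain x where x: "a \<in> carrier S" "t = act_class a" "x \<in> carrier S" "r = act_class (a \<otimes> x)"
      using act_class_coset_cases[OF *(1,4,2)] .
    then obtain y where y: "y \<in> carrier S" "q = act_class (a \<otimes> x \<otimes> y)"
      using *(3) m_closed by (auto simp: act_quotient_coset)
    \<comment> \<open>Both sides equal \<open>a \<otimes> x \<otimes> y\<close>: the left one by two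
      applications of \<open>act_map_eq\<close>, the right one by a single application with factor
      \<open>x \<otimes> y\<close>.\<close>
    show "act_map r q (act_map t r a) = act_map t q a"
      using x y by (metis act_map_eq m_assoc m_closed)
  qed
qed

lemma iso_constr1_act_quotient: "S \<cong> constr1 act_quotient (\<lambda>t. t) act_map"
proof -
  interpret C: construction1 act_quotient "\<lambda>t. t" act_map
    by (rule construction1_act_quotient)
  have "carrier (constr1 act_quotient (\<lambda>t. t) act_map) = carrier S"
    using mem_act_class_iff by (auto simp: constr1_def act_quotient_carrier)
  \<comment> \<open>The constructed product is \<open>act_map\<close> from the class of
    \<open>a\<close> to the class of \<open>a \<otimes> b\<close>, applied to \<open>a\<close>; here
    \<open>b\<close> is an admissible factor.\<close>
  moreover have "a \<otimes>\<^bsub>constr1 act_quotient (\<lambda>t. t) act_map\<^esub> b = a \<otimes> b"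
    if "a \<in> carrier S" "b \<in> carrier S" for a b
    using that C.mult_constr1[of "act_class a" "act_class b" a b]
    by (simp add: act_quotient_carrier mem_act_class_iff act_quotient_mult act_map_eq)
  ultimately have "(\<lambda>a. a) \<in> iso S (constr1 act_quotient (\<lambda>t. t) act_map)"
    by (auto simp: iso_def hom_def bij_betw_def m_closed)
  then show ?thesis
    by (auto simp: is_iso_def)
qed

end

text \<open>Types cannot be quantified inside a formula. The equivalence therefore fixes the types
  in which the witnesses live, with classes as indices, and the second conjunct gives the converse
  for data over arbitrary types.\<close>

theorem theorem2p2:
  fixes S :: "('a, 'm) monoid_scheme"
  assumes "semigrp S"
  shows "(left_equalizer_simple S \<longleftrightarrow>
      (\<exists>(T :: 'a set monoid) (A :: 'a set \<Rightarrow> 'a set) f.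
        construction1 T A f \<and> S \<cong> constr1 T A f)) \<and>
    ((\<exists>(T :: ('t, 'n) monoid_scheme) (A :: 't \<Rightarrow> 's set) f.
        construction1 T A f \<and> S \<cong> constr1 T A f) \<longrightarrow> left_equalizer_simple S)"
proof (intro conjI iffI impI)
  assume "left_equalizer_simple S"
  then have "construction1 (semigrp.act_quotient S) (\<lambda>t. t) (semigrp.act_map S) \<and>
      S \<cong> constr1 (semigrp.act_quotient S) (\<lambda>t. t) (semigrp.act_map S)"
    by (intro conjI construction1_act_quotient iso_constr1_act_quotient)
  then show "\<exists>(T :: 'a set monoid) (A :: 'a set \<Rightarrow> 'a set) f.
      construction1 T A f \<and> S \<cong> constr1 T A f"
    by (intro exI)
next
  assume "\<exists>(T :: 'a set monoid) (A :: 'a set \<Rightarrow> 'a set) f.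
      construction1 T A f \<and> S \<cong> constr1 T A f"
  then show "left_equalizer_simple S"
    by (elim exE conjE)
      (rule left_equalizer_simple_iso[OF assms _ construction1.left_equalizer_simple_constr1])
next
  assume "\<exists>(T :: ('t, 'n) monoid_scheme) (A :: 't \<Rightarrow> 's set) f.
      construction1 T A f \<and> S \<cong> constr1 T A f"
  then show "left_equalizer_simple S"
    by (elim exE conjE)
      (rule left_equalizer_simple_iso[OF assms _ construction1.left_equalizer_simple_constr1])
qed

end
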